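(* Let $G\subseteq\mathbb{C}$ be a domain, let $\lambda(z)\,|dz|$ be an SK-metric on $G$ and let $\mu(z)\,|dz|$ be an SK-metric on an open subset $U$ of $G$ such that $$\limsup_{U\ni z\to\xi}\mu(z)\le\lambda(\xi)\qquad\text{for all }\xi\in\partial U\cap G .$$ Then $\sigma(z)\,|dz|$ defined by $$\sigma(z):=\begin{cases}\max\{\lambda(z),\mu(z)\} & \text{for } z\in U,\\ \lambda(z) & \text{for } z\in G\setminus U\end{cases}$$ is an SK-metric on $G$.
   Context: A conformal pseudo-metric $\lambda(z)\,|dz|$ on an open set $G\subseteq\mathbb{C}$ is given by a continuous function $\lambda:G\to[0,+\infty)$, $\lambda\not\equiv 0$ (its density). For a continuous real-valued function $u$ near a point $z$, the generalized lower Laplace operator is $\Delta u(z)=\liminf_{r\to 0}\frac{4}{r^2}\left(\frac{1}{2\pi}\int_0^{2\pi}u(z+re^{it})\,dt-u(z)\right)$. At a point $z\in G$ with $\lambda(z)>0$ the curvature of $\lambda(z)\,|dz|$ is $\kappa_\lambda(z)=-\Delta(\log\lambda)(z)/\lambda(z)^2$. The pseudo-metric $\lambda(z)\,|dz|$ is called an SK-metric on $G$ if $\kappa_\lambda(z)\le -1$ at every $z\in G$ with $\lambda(z)>0$. $\partial U$ denotes the boundary of $U$ in $\mathbb{C}$. *)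

theory Defs
  imports "HOL-Analysis.Analysis"
begin

text \<open>
  Densities are total functions \<^typ>\<open>complex \<Rightarrow> real\<close>; their values outside the open set on which the
  metric lives play no role. The generalized Laplacian and the curvature take extended real values,
  since the lower limit may be infinite. The lower limit as \<open>r\<close> tends to \<open>0\<close> runs over radii \<open>r > 0\<close>,
  so only values of \<open>u\<close> near \<open>z\<close> matter.
\<close>

definition gen_laplacian :: "(complex \<Rightarrow> real) \<Rightarrow> complex \<Rightarrow> ereal" where
  "gen_laplacian u z =
     Liminf (at_right 0)
       (\<lambda>r::real. ereal (4 / r\<^sup>2 *
          (1 / (2 * pi) * integral {0..2 * pi} (\<lambda>t. u (z + of_real r * exp (\<i> * of_real t))) - u z)))"

text \<open>Meaningful only at points where the density is positive.\<close>

definition curvature :: "(complex \<Rightarrow> real) \<Rightarrow> complex \<Rightarrow> ereal" where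
  "curvature d z = - gen_laplacian (\<lambda>w. ln (d w)) z / ereal ((d z)\<^sup>2)"

definition conformal_pseudo_metric_on :: "complex set \<Rightarrow> (complex \<Rightarrow> real) \<Rightarrow> bool" where
  "conformal_pseudo_metric_on G d \<longleftrightarrow>
     open G \<and> continuous_on G d \<and> (\<forall>z\<in>G. d z \<ge> 0) \<and> (\<exists>z\<in>G. d z \<noteq> 0)"

definition SK_metric_on :: "complex set \<Rightarrow> (complex \<Rightarrow> real) \<Rightarrow> bool" where
  "SK_metric_on G d \<longleftrightarrow>
     conformal_pseudo_metric_on G d \<and> (\<forall>z\<in>G. d z > 0 \<longrightarrow> curvature d z \<le> -1)"

end

theory Submission
  imports Defs
begin

text \<open>
  Curvature obeys a touching principle: if a continuous density \<open>e\<close> lies above a continuous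
  density \<open>d\<close> near \<open>z\<close> and both take the same positive value at \<open>z\<close>, then the circular means of
  \<open>log e\<close> about \<open>z\<close> dominate those of \<open>log d\<close> while the central values agree. Hence
  \<open>\<Delta>(log e)(z) \<ge> \<Delta>(log d)(z)\<close>, and since the curvatures have the same denominator, the curvature
  of \<open>e\<close> at \<open>z\<close> is at most that of \<open>d\<close> (\<open>curvature_le_if_touching_above\<close>).

  The glued density \<open>\<sigma>\<close> satisfies \<open>\<sigma> \<ge> l\<close> on \<open>G\<close> and \<open>\<sigma> \<ge> \<mu>\<close> on \<open>U\<close>, and at each point it equals one
  of these two. So wherever \<open>\<sigma>\<close> is positive, it touches from above a density of curvature at
  most \<open>-1\<close>. The boundary hypothesis supplies continuity: it keeps \<open>\<sigma>\<close> from jumping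
  upwards on \<open>\<partial>U\<close> (\<open>continuous_on_glued_max\<close>), and the circular means of \<open>log \<sigma>\<close> about a boundary
  point can then be compared with those of \<open>log l\<close>.
\<close>

lemma integrable_on_circle:
  fixes u :: "complex \<Rightarrow> real"
  assumes "continuous_on (ball z \<rho>) u" and "0 < r" and "r < \<rho>"
  shows "(\<lambda>t. u (z + of_real r * exp (\<i> * of_real t))) integrable_on {0..2 * pi}"
proof (rule integrable_continuous_real)
  show "continuous_on {0..2 * pi} (\<lambda>t. u (z + of_real r * exp (\<i> * of_real t)))"
    by (rule continuous_on_compose2[OF assms(1)], intro continuous_intros)
       (use assms in \<open>auto simp: dist_norm norm_mult\<close>)
qed

lemma gen_laplacian_mono_at_touching_point:
  fixes u v :: "complex \<Rightarrow> real"
  assumes "0 < \<rho>" and u: "continuous_on (ball z \<rho>) u" and v: "continuous_on (ball z \<rho>) v"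
    and le: "\<And>w. w \<in> ball z \<rho> \<Longrightarrow> u w \<le> v w" and eq: "u z = v z"
  shows "gen_laplacian u z \<le> gen_laplacian v z"
  unfolding gen_laplacian_def
proof (rule Liminf_mono)
  have "eventually (\<lambda>r. 0 < r \<and> r < \<rho>) (at_right (0::real))"
    using \<open>0 < \<rho>\<close> by (auto simp: eventually_at_right_field)
  then show "\<forall>\<^sub>F r in at_right 0.
      ereal (4 / r\<^sup>2 *
        (1 / (2 * pi) * integral {0..2 * pi} (\<lambda>t. u (z + of_real r * exp (\<i> * of_real t))) - u z))
      \<le> ereal (4 / r\<^sup>2 *
        (1 / (2 * pi) * integral {0..2 * pi} (\<lambda>t. v (z + of_real r * exp (\<i> * of_real t))) - v z))"
  proof eventually_elim
    case (elim r)
    have "integral {0..2 * pi} (\<lambda>t. u (z + of_real r * exp (\<i> * of_real t)))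
        \<le> integral {0..2 * pi} (\<lambda>t. v (z + of_real r * exp (\<i> * of_real t)))"
      using elim
      by (intro integral_le integrable_on_circle[OF u] integrable_on_circle[OF v] le)
         (auto simp: dist_norm norm_mult)
    then show ?case
      unfolding eq ereal_less_eq
      by (intro mult_left_mono diff_right_mono) auto
  qed
qed

text \<open>
  Positivity spreads from the touching point: by continuity \<open>d > 0\<close> near \<open>z\<close>, hence \<open>e > 0\<close> there
  too, so both logarithms are continuous near \<open>z\<close> and \<open>d \<le> e\<close> passes to them. The denominators
  \<open>(d z)\<^sup>2\<close> and \<open>(e z)\<^sup>2\<close> agree, which leaves the comparison of the Laplacians.
\<close>

lemma curvature_le_if_touching_above:
  assumes "open V" and "z \<in> V" and d: "continuous_on V d" and e: "continuous_on V e"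
    and le: "\<And>w. w \<in> V \<Longrightarrow> d w \<le> e w" and eq: "d z = e z" and pos: "0 < d z"
  shows "curvature e z \<le> curvature d z"
proof -
  have "open (V \<inter> d -` {0<..})"
    by (rule continuous_open_preimage[OF d \<open>open V\<close> open_greaterThan])
  moreover have "z \<in> V \<inter> d -` {0<..}"
    using \<open>z \<in> V\<close> pos by simp
  ultimately obtain \<rho> where \<rho>: "0 < \<rho>" "ball z \<rho> \<subseteq> V \<inter> d -` {0<..}"
    using openE by blast
  then have in_V: "w \<in> V" and d_pos: "0 < d w" if "w \<in> ball z \<rho>" for w
    using that by auto
  have e_pos: "0 < e w" if "w \<in> ball z \<rho>" for w
    using d_pos[OF that] le[OF in_V[OF that]] by linarith
  have "continuous_on (ball z \<rho>) d" "continuous_on (ball z \<rho>) e"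
    using d e \<rho>(2) by (auto intro: continuous_on_subset)
  then have "gen_laplacian (\<lambda>w. ln (d w)) z \<le> gen_laplacian (\<lambda>w. ln (e w)) z"
    using d_pos e_pos le in_V eq \<rho>(1)
    by (intro gen_laplacian_mono_at_touching_point[of \<rho>] continuous_on_ln) force+
  then show ?thesis
    unfolding curvature_def eq[symmetric]
    using pos by (intro ereal_divide_right_mono) auto
qed

text \<open>
  Only boundary points of \<open>U\<close> are delicate. There the glued function has the value \<open>f \<xi>\<close>; the bound
  from below near \<open>\<xi>\<close> comes from \<open>f\<close> alone, and the bound from above is exactly what the upper limit
  of \<open>g\<close> provides.
\<close>

lemma continuous_on_glued_max:
  fixes f g :: "'a :: metric_space \<Rightarrow> real"
  assumes "open G" and "open U" and "U \<subseteq> G"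
    and f: "continuous_on G f" and g: "continuous_on U g"
    and limsup: "\<And>\<xi>. \<xi> \<in> frontier U \<inter> G \<Longrightarrow>
      Limsup (at \<xi> within U) (\<lambda>z. ereal (g z)) \<le> ereal (f \<xi>)"
  shows "continuous_on G (\<lambda>z. if z \<in> U then max (f z) (g z) else f z)" (is "continuous_on G ?s")
proof -
  have f_at: "isCont f z" if "z \<in> G" for z
    using f \<open>open G\<close> that continuous_on_eq_continuous_at by blast
  have "isCont ?s z" if "z \<in> G" for z
  proof -
    consider "z \<in> U" | "z \<in> - closure U" | "z \<in> frontier U"
      using \<open>open U\<close> by (auto simp: frontier_def interior_open)
    then show ?thesis
    proof cases
      case 1
      have "continuous_on U (\<lambda>z. max (f z) (g z))"
        by (intro continuous_intros continuous_on_subset[OF f] \<open>U \<subseteq> G\<close> g)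
      then have "continuous_on U ?s"
        by (rule continuous_on_eq) simp
      with 1 \<open>open U\<close> show ?thesis
        using continuous_on_eq_continuous_at by blast
    next
      case 2
      have "\<forall>\<^sub>F w in nhds z. w \<in> - closure U"
        using 2 by (intro eventually_nhds_in_open) auto
      then have "\<forall>\<^sub>F w in nhds z. ?s w = f w"
        by eventually_elim (use closure_subset in auto)
      then show ?thesis
        using f_at[OF that] by (simp only: isCont_cong)
    next
      case 3
      then have z: "z \<notin> U"
        using \<open>open U\<close> by (simp add: frontier_def interior_open)
      have f_lim: "(f \<longlongrightarrow> f z) (at z)"
        using f_at[OF that] by (simp add: isCont_def)
      have "(?s \<longlongrightarrow> f z) (at z)"
      proof (rule order_tendstoI)
        fix a assume "a < f z"
        then have "\<forall>\<^sub>F w in at z. a < f w"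
          using f_lim order_tendstoD(1) by blast
        then show "\<forall>\<^sub>F w in at z. a < ?s w"
          by eventually_elim auto
      next
        fix a assume a: "f z < a"
        have "Limsup (at z within U) (\<lambda>w. ereal (g w)) < ereal a"
          using limsup[of z] 3 that a le_less_trans by fastforce
        then have "\<forall>\<^sub>F w in at z within U. ereal (g w) < ereal a"
          by (rule Limsup_lessD)
        then have "\<forall>\<^sub>F w in at z. w \<in> U \<longrightarrow> g w < a"
          by (auto simp: eventually_at_filter elim!: eventually_mono)
        moreover have "\<forall>\<^sub>F w in at z. f w < a"
          using f_lim a order_tendstoD(2) by blast
        ultimately show "\<forall>\<^sub>F w in at z. ?s w < a"
          by eventually_elim auto
      qed
      with z show ?thesis
        by (simp add: isCont_def)
    qed
  qed
  then show ?thesis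
    by (intro continuous_at_imp_continuous_on ballI)
qed

theorem lemma4p6:
  fixes G U :: "complex set" and l \<mu> :: "complex \<Rightarrow> real"
  assumes "open G" and "connected G" and "G \<noteq> {}"
    and "SK_metric_on G l"
    and "open U" and "U \<subseteq> G"
    and "SK_metric_on U \<mu>"
    and "\<And>\<xi>. \<xi> \<in> frontier U \<inter> G \<Longrightarrow>
           Limsup (at \<xi> within U) (\<lambda>z. ereal (\<mu> z)) \<le> ereal (l \<xi>)"
  shows "SK_metric_on G (\<lambda>z. if z \<in> U then max (l z) (\<mu> z) else l z)"
proof -
  let ?s = "\<lambda>z. if z \<in> U then max (l z) (\<mu> z) else l z"
  have l: "continuous_on G l" "\<And>z. z \<in> G \<Longrightarrow> 0 \<le> l z" "\<exists>z\<in>G. l z \<noteq> 0"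
      "\<And>z. z \<in> G \<Longrightarrow> 0 < l z \<Longrightarrow> curvature l z \<le> -1"
    using \<open>SK_metric_on G l\<close> by (auto simp: SK_metric_on_def conformal_pseudo_metric_on_def)
  have \<mu>: "continuous_on U \<mu>" "\<And>z. z \<in> U \<Longrightarrow> 0 < \<mu> z \<Longrightarrow> curvature \<mu> z \<le> -1"
    using \<open>SK_metric_on U \<mu>\<close> by (auto simp: SK_metric_on_def conformal_pseudo_metric_on_def)
  have s: "continuous_on G ?s"
    by (rule continuous_on_glued_max)
       (use \<open>open G\<close> \<open>open U\<close> \<open>U \<subseteq> G\<close> l(1) \<mu>(1) assms(8) in auto)
  have s_ge_l: "l z \<le> ?s z" for z
    by simp
  obtain z\<^sub>0 where "z\<^sub>0 \<in> G" "l z\<^sub>0 \<noteq> 0"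
    using l(3) by blast
  then have "?s z\<^sub>0 \<noteq> 0"
    using l(2)[of z\<^sub>0] s_ge_l[of z\<^sub>0] by linarith
  moreover have "0 \<le> ?s z" if "z \<in> G" for z
    using l(2)[OF that] s_ge_l[of z] by linarith
  ultimately have "conformal_pseudo_metric_on G ?s"
    using \<open>open G\<close> s \<open>z\<^sub>0 \<in> G\<close> by (auto simp only: conformal_pseudo_metric_on_def)
  moreover have "curvature ?s z \<le> -1" if "z \<in> G" and pos: "0 < ?s z" for z
  proof -
    consider "l z = ?s z" | "z \<in> U" "\<mu> z = ?s z"
      by (cases "z \<in> U"; cases "l z \<le> \<mu> z") auto
    then show ?thesis
    proof cases
      case 1
      have "curvature ?s z \<le> curvature l z"
        by (rule curvature_le_if_touching_above[OF \<open>open G\<close> \<open>z \<in> G\<close> l(1) s s_ge_l 1])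
           (use 1 pos in linarith)
      also have "\<dots> \<le> -1"
        using 1 pos \<open>z \<in> G\<close> by (intro l(4)) linarith+
      finally show ?thesis .
    next
      case 2
      have s_U: "continuous_on U ?s"
        using s \<open>U \<subseteq> G\<close> by (rule continuous_on_subset)
      have "curvature ?s z \<le> curvature \<mu> z"
        by (rule curvature_le_if_touching_above[OF \<open>open U\<close> 2(1) \<mu>(1) s_U _ 2(2)])
           (use 2 pos in \<open>simp, linarith\<close>)
      also have "\<dots> \<le> -1"
        using 2 pos by (intro \<mu>(2)) linarith+
      finally show ?thesis .
    qed
  qed
  ultimately show ?thesis
    unfolding SK_metric_on_def by blast
qed

end
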